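(* Let $d \ge 1$, $L > 0$, let $f \in \mathcal{F}_L^1(\mathbb{R}^d)$ have a minimizer $x^\star$, let $r \ge 2$ be a real number, let $s > 0$, and let $x_0 \in \mathbb{R}^d$. Let $X = X(t)$, $t \ge (r-1)\sqrt{s}/2$, be the solution to the implicit-velocity high-resolution differential equation $$\ddot{X}(t) + \frac{r+1}{t}\dot{X}(t) + \left[ 1 + \frac{(r+1)\sqrt{s}}{2t} \right] \nabla f\left( X(t) + \sqrt{s}\,\dot{X}(t) \right) = 0$$ with $X\left((r-1)\sqrt{s}/2\right) = x_0$ and $\dot{X}\left((r-1)\sqrt{s}/2\right) = -\sqrt{s}\,\nabla f(x_0)$. Put $t_0 = (r+2)\sqrt{s}$. Then $$f\left(X(t) + \sqrt{s}\,\dot{X}(t)\right) - f(x^\star) \le \frac{\mathcal{E}(t_0)}{t^2} \quad \text{for all } t \ge t_0,$$ where $\mathcal{E}$ is the Lyapunov function given in the context, and $$\lim_{t \to \infty} \left( t^3 \inf_{t_0 \le u \le t} \left\| \nabla f\left(X(u) + \sqrt{s}\,\dot{X}(u)\right) \right\|^2 \right) = 0.$$ Furthermore, when $r > 2$, $$\lim_{t \to \infty} \left[ t^2 \left( \inf_{t_0 \le u \le t} f\left(X(u) + \sqrt{s}\,\dot{X}(u)\right) - f(x^\star) \right) \right] = 0.$$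
   Context: $\|\cdot\|$ is the Euclidean norm. $\mathcal{F}_L^1(\mathbb{R}^d)$ is the class of $L$-smooth convex functions: differentiable $f : \mathbb{R}^d \to \mathbb{R}$ with $f(y) \ge f(x) + \langle \nabla f(x), y - x \rangle$ and $\|\nabla f(x) - \nabla f(y)\| \le L \|x - y\|$ for all $x, y \in \mathbb{R}^d$. $x^\star$ denotes a minimizer of $f$ (assumed to exist). Dots denote derivatives with respect to $t$. The Lyapunov function along the solution $X$ is defined for $t \ge t_0 = (r+2)\sqrt{s}$ by $$\mathcal{E}(t) = \frac{t(t - r\sqrt{s})}{t - (r+1)\sqrt{s}} \left[ t + \frac{(r+1)\sqrt{s}}{2} \right] \left( f\left(X(t) + \sqrt{s}\,\dot{X}(t)\right) - f(x^\star) \right) + \frac{1}{2} \left\| t\dot{X}(t) + r\left(X(t) - x^\star\right) \right\|^2.$$ *)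

theory Defs
  imports "HOL-Analysis.Analysis"
begin

definition gradient :: "('a::real_inner \<Rightarrow> real) \<Rightarrow> 'a \<Rightarrow> 'a" where
  "gradient f x = (THE D. GDERIV f x :> D)"

lemma gradient_eqI:
  assumes "GDERIV f x :> D"
  shows "gradient f x = D"
  unfolding gradient_def
proof (rule the_equality)
  show "GDERIV f x :> D" by fact
next
  fix D' assume "GDERIV f x :> D'"
  then have "(\<lambda>h. h \<bullet> D') = (\<lambda>h. h \<bullet> D)"
    using assms unfolding gderiv_def by (rule has_derivative_unique)
  then have "h \<bullet> D' = h \<bullet> D" for h by meson
  then show "D' = D" using vector_eq_ldot[of D' D] by blast
qed

lemma GDERIV_gradient:
  fixes f :: "'a::euclidean_space \<Rightarrow> real"
  assumes "f differentiable (at x)"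
  shows "GDERIV f x :> gradient f x"
proof -
  obtain f' where f': "(f has_derivative f') (at x)"
    using assms unfolding differentiable_def by blast
  then have "linear f'" by (rule has_derivative_linear)
  then have "f' = (\<lambda>h. h \<bullet> adjoint f' 1)"
    by (simp add: fun_eq_iff adjoint_works)
  then have "GDERIV f x :> adjoint f' 1"
    using f' unfolding gderiv_def by simp
  then show ?thesis using gradient_eqI by metis
qed

definition smooth_convex :: "real \<Rightarrow> (real ^ 'd \<Rightarrow> real) set" where
  "smooth_convex L = {f.
     (\<forall>x. f differentiable (at x)) \<and>
     (\<forall>x y. f y \<ge> f x + gradient f x \<bullet> (y - x)) \<and>
     (\<forall>x y. norm (gradient f x - gradient f y) \<le> L * norm (x - y))}"

text \<open>\<open>X'\<close> and \<open>X''\<close> stand for the first two time derivatives of \<open>X\<close>. The derivatives are taken within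
  the half-line on which the equation is posed, hence one-sided at its left end point.\<close>

definition is_solution ::
  "(real ^ 'd \<Rightarrow> real) \<Rightarrow> real \<Rightarrow> real \<Rightarrow> real ^ 'd \<Rightarrow>
   (real \<Rightarrow> real ^ 'd) \<Rightarrow> (real \<Rightarrow> real ^ 'd) \<Rightarrow> (real \<Rightarrow> real ^ 'd) \<Rightarrow> bool" where
  "is_solution f r s x0 X X' X'' \<longleftrightarrow>
     (let a = (r - 1) * sqrt s / 2 in
       (\<forall>t\<ge>a. (X has_vector_derivative X' t) (at t within {a..})) \<and>
       (\<forall>t\<ge>a. (X' has_vector_derivative X'' t) (at t within {a..})) \<and>
       (\<forall>t\<ge>a. X'' t + ((r + 1) / t) *\<^sub>R X' t
          + (1 + (r + 1) * sqrt s / (2 * t)) *\<^sub>R gradient f (X t + sqrt s *\<^sub>R X' t) = 0) \<and>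
       X a = x0 \<and>
       X' a = - sqrt s *\<^sub>R gradient f x0)"

definition lyapunov ::
  "(real ^ 'd \<Rightarrow> real) \<Rightarrow> real \<Rightarrow> real \<Rightarrow> real ^ 'd \<Rightarrow>
   (real \<Rightarrow> real ^ 'd) \<Rightarrow> (real \<Rightarrow> real ^ 'd) \<Rightarrow> real \<Rightarrow> real" where
  "lyapunov f r s xstar X X' t =
     t * (t - r * sqrt s) / (t - (r + 1) * sqrt s) * (t + (r + 1) * sqrt s / 2)
       * (f (X t + sqrt s *\<^sub>R X' t) - f xstar)
     + 1 / 2 * (norm (t *\<^sub>R X' t + r *\<^sub>R (X t - xstar)))\<^sup>2"

end

theory Submission
  imports Defs
begin

text \<open>Write \<open>Y = X + \<surd>s X'\<close>, \<open>\<Phi> = f(Y) - f(x\<^sup>*)\<close>, \<open>g = \<nabla>f(Y)\<close>. In the derivative of the Lyapunov function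
  \<open>\<E>\<close> the terms in \<open>g \<bullet> X'\<close> cancel, and convexity leaves
  \<open>\<E>' \<le> - (r - 2) t \<Phi> - \<surd>s t\<^sup>2 \<parallel>g\<parallel>\<^sup>2\<close> for \<open>t \<ge> t\<^sub>0\<close>. Hence \<open>\<E>\<close> decreases, which gives the bound on
  \<open>\<Phi>\<close>, and it converges, so that \<open>\<E>(t/2) - \<E>(t) \<rightarrow> 0\<close>; comparing this difference with the least value
  of \<open>\<parallel>g\<parallel>\<^sup>2\<close> or \<open>\<Phi>\<close> on \<open>[t\<^sub>0, t]\<close> gives the two limits.\<close>

section \<open>Decay of running infima from a differential inequality\<close>

lemma antimono_bounded_below_tendsto:
  fixes E :: "real \<Rightarrow> real"
  assumes anti: "\<And>u v. a \<le> u \<Longrightarrow> u \<le> v \<Longrightarrow> E v \<le> E u"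
    and bound: "\<And>u. a \<le> u \<Longrightarrow> B \<le> E u"
  obtains l where "(E \<longlongrightarrow> l) at_top"
proof
  have bdd: "bdd_below (E ` {a..})"
    using bound by (intro bdd_belowI2[where m = B]) auto
  show "(E \<longlongrightarrow> (INF u\<in>{a..}. E u)) at_top"
  proof (rule decreasing_tendsto)
    show "\<forall>\<^sub>F t in at_top. (INF u\<in>{a..}. E u) \<le> E t"
      using eventually_ge_at_top[of a]
      by eventually_elim (use bdd in \<open>auto intro: cINF_lower\<close>)
  next
    fix x assume "(INF u\<in>{a..}. E u) < x"
    then obtain u where u: "u \<ge> a" "E u < x"
      using bdd by (subst (asm) cINF_less_iff) auto
    show "\<forall>\<^sub>F t in at_top. E t < x"
      using eventually_ge_at_top[of u]
      by eventually_elim (use anti u in force)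
  qed
qed

text \<open>On [t/2, t] the function \<open>E\<close> falls at a rate of at least
  \<open>k * (t/2)^n * m\<close>, where \<open>m\<close> is the infimum of \<open>\<phi>\<close>
  over [t0, t]. The interval has length t/2, so \<open>E (t/2) - E t\<close> is at least
  \<open>k * (t/2)^(n+1) * m\<close>. Being nonincreasing and nonnegative, \<open>E\<close>
  converges, and this difference tends to 0.\<close>

lemma tendsto_power_times_INF:
  fixes E \<phi> :: "real \<Rightarrow> real"
  assumes k: "k > 0" and t0: "t0 > 0"
    and deriv: "\<And>t. t \<ge> t0 \<Longrightarrow> \<exists>D. (E has_real_derivative D) (at t) \<and> D \<le> - (k * t ^ n * \<phi> t)"
    and E0: "\<And>t. t \<ge> t0 \<Longrightarrow> E t \<ge> 0"
    and \<phi>0: "\<And>t. t \<ge> t0 \<Longrightarrow> \<phi> t \<ge> 0"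
  shows "((\<lambda>t. t ^ Suc n * (INF u\<in>{t0..t}. \<phi> u)) \<longlongrightarrow> 0) at_top"
proof -
  have anti: "E v \<le> E u" if "t0 \<le> u" "u \<le> v" for u v
  proof (rule DERIV_nonpos_imp_nonincreasing[OF that(2)])
    fix x assume x: "u \<le> x" "x \<le> v"
    have "k * x ^ n * \<phi> x \<ge> 0"
      using k t0 \<phi>0[of x] x that by simp
    then show "\<exists>y. (E has_real_derivative y) (at x) \<and> y \<le> 0"
      using deriv[of x] x that by force
  qed
  obtain l where l: "(E \<longlongrightarrow> l) at_top"
    using antimono_bounded_below_tendsto[where a = t0 and E = E and B = 0] anti E0 by metis
  have "filterlim (\<lambda>t::real. 1 / 2 * t) at_top at_top"
    by (intro filterlim_tendsto_pos_mult_at_top[OF tendsto_const] filterlim_ident) simp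
  then have "filterlim (\<lambda>t::real. t / 2) at_top at_top"
    by simp
  then have "((\<lambda>t. E (t / 2)) \<longlongrightarrow> l) at_top"
    by (rule filterlim_compose[OF l])
  \<comment> \<open>The factor \<open>2 ^ Suc n / k\<close> turns the bound on
    \<open>k * (t/2) ^ Suc n * m\<close> into one on \<open>t ^ Suc n * m\<close>.\<close>
  then have "((\<lambda>t. 2 ^ Suc n / k * (E (t / 2) - E t)) \<longlongrightarrow> 2 ^ Suc n / k * (l - l)) at_top"
    by (intro tendsto_intros l)
  then have upper: "((\<lambda>t. 2 ^ Suc n / k * (E (t / 2) - E t)) \<longlongrightarrow> 0) at_top"
    by simp
  show ?thesis
  proof (rule tendsto_sandwich[OF _ _ tendsto_const upper])
    show "\<forall>\<^sub>F t in at_top. 0 \<le> t ^ Suc n * (INF u\<in>{t0..t}. \<phi> u)"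
      using eventually_ge_at_top[of t0]
    proof eventually_elim
      case (elim t)
      have "0 \<le> (INF u\<in>{t0..t}. \<phi> u)"
        using elim \<phi>0 by (intro cINF_greatest) auto
      then show ?case using elim t0 by simp
    qed
    show "\<forall>\<^sub>F t in at_top. t ^ Suc n * (INF u\<in>{t0..t}. \<phi> u) \<le> 2 ^ Suc n / k * (E (t / 2) - E t)"
      \<comment> \<open>From \<open>2 * t0\<close> on, all of [t/2, t] lies to the right of
        \<open>t0\<close>, where the derivative bound applies.\<close>
      using eventually_ge_at_top[of "2 * t0"]
    proof eventually_elim
      case (elim t)
      define m where "m = (INF u\<in>{t0..t}. \<phi> u)"
      \<comment> \<open>A uniform lower bound for the rate of decrease on [t/2, t]. Hence
        \<open>E u + c * u\<close> is nonincreasing there, and comparing its end values replaces an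
        integration.\<close>
      define c where "c = k * (t / 2) ^ n * m"
      have m0: "0 \<le> m"
        unfolding m_def using elim t0 \<phi>0 by (intro cINF_greatest) auto
      have m_le: "m \<le> \<phi> u" if "t0 \<le> u" "u \<le> t" for u
        unfolding m_def using that \<phi>0 by (intro cINF_lower bdd_belowI2[where m = 0]) auto
      have "E t + c * t \<le> E (t / 2) + c * (t / 2)"
      proof (rule DERIV_nonpos_imp_nonincreasing[where f = "\<lambda>u. E u + c * u"])
        show "t / 2 \<le> t" using elim t0 by simp
      next
        fix u assume u: "t / 2 \<le> u" "u \<le> t"
        have ut0: "t0 \<le> u" using u elim by simp
        obtain D where D: "(E has_real_derivative D) (at u)" "D \<le> - (k * u ^ n * \<phi> u)"
          using deriv[OF ut0] by blast
        have "(t / 2) ^ n * m \<le> u ^ n * \<phi> u"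
          using u elim t0 m0 m_le[OF ut0 u(2)] by (intro mult_mono power_mono) auto
        then have "c \<le> k * u ^ n * \<phi> u"
          unfolding c_def using k by simp
        moreover have "((\<lambda>u. E u + c * u) has_real_derivative (D + c)) (at u)"
          by (auto intro!: derivative_eq_intros D)
        ultimately show "\<exists>y. ((\<lambda>u. E u + c * u) has_real_derivative y) (at u) \<and> y \<le> 0"
          using D(2) by force
      qed
      then have "k * (t / 2) ^ Suc n * m \<le> E (t / 2) - E t"
        unfolding c_def by (simp add: algebra_simps)
      then have "t ^ Suc n * m \<le> 2 ^ Suc n / k * (E (t / 2) - E t)"
        using k by (simp add: power_divide field_simps del: power_Suc)
      then show ?case unfolding m_def .
    qed
  qed
qed

text \<open>Moves \<open>f xstar\<close> out of the infimum in the last limit. The bound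
  \<open>c\<close> keeps both families bounded below, which \<open>cINF_lower\<close> asks
  for.\<close>

lemma INF_diff_const:
  fixes \<phi> :: "'a \<Rightarrow> real"
  assumes "A \<noteq> {}" "\<And>u. u \<in> A \<Longrightarrow> c \<le> \<phi> u"
  shows "(INF u\<in>A. \<phi> u - c) = (INF u\<in>A. \<phi> u) - c"
proof (rule antisym)
  have "(INF u\<in>A. \<phi> u - c) + c \<le> \<phi> u" if "u \<in> A" for u
  proof -
    have "(INF u\<in>A. \<phi> u - c) \<le> \<phi> u - c"
      using that assms by (intro cINF_lower bdd_belowI2[where m = 0]) auto
    then show ?thesis by simp
  qed
  then have "(INF u\<in>A. \<phi> u - c) + c \<le> (INF u\<in>A. \<phi> u)"
    using assms(1) by (rule cINF_greatest[rotated])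
  then show "(INF u\<in>A. \<phi> u - c) \<le> (INF u\<in>A. \<phi> u) - c" by simp
  show "(INF u\<in>A. \<phi> u) - c \<le> (INF u\<in>A. \<phi> u - c)"
    using assms by (intro cINF_greatest diff_right_mono cINF_lower bdd_belowI2[where m = c]) auto
qed

section \<open>The coefficient of the function gap in the Lyapunov function, with
  \<open>\<sigma>\<close> for \<open>sqrt s\<close>\<close>

definition weight :: "real \<Rightarrow> real \<Rightarrow> real \<Rightarrow> real" where
  "weight r \<sigma> t = t * (t - r * \<sigma>) / (t - (r + 1) * \<sigma>) * (t + (r + 1) * \<sigma> / 2)"

text \<open>For such \<open>t\<close> the denominator is at least \<open>\<sigma>\<close>, and the
  numerator \<open>t - r * \<sigma>\<close> exceeds it by \<open>\<sigma>\<close>, so the quotient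
  is at least 1; the last factor is at least \<open>t\<close>.\<close>

lemma weight_ge:
  assumes "\<sigma> > 0" "r \<ge> 2" "t \<ge> (r + 2) * \<sigma>"
  shows "t\<^sup>2 \<le> weight r \<sigma> t"
proof -
  have u: "t - (r + 1) * \<sigma> > 0" and t: "t > 0"
    using assms mult_pos_pos[of "r + 2" \<sigma>] by (auto simp: algebra_simps)
  define q where "q = (t - r * \<sigma>) / (t - (r + 1) * \<sigma>)"
  have "1 \<le> q"
    unfolding q_def using u assms by (simp add: le_divide_eq algebra_simps)
  moreover have "t \<le> t + (r + 1) * \<sigma> / 2"
    using assms by simp
  ultimately have "t * 1 * t \<le> t * q * (t + (r + 1) * \<sigma> / 2)"
    using t by (intro mult_mono) auto
  then show ?thesis by (simp add: weight_def q_def power2_eq_square)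
qed

text \<open>With b = (r+1) \<open>\<sigma>\<close>, division with remainder writes the weight as t^2
  + b t/2 + \<open>\<sigma>\<close> (t + 3b/2 + 3b^2 / (2(t-b))). Only the last summand contributes
  the subtracted fraction, whose sign is favourable later.\<close>

lemma weight_deriv:
  assumes "t \<noteq> (r + 1) * \<sigma>"
  shows "(weight r \<sigma> has_real_derivative
      2 * t + (r + 1) * \<sigma> / 2 + \<sigma> - 3 * \<sigma> * ((r + 1) * \<sigma>)\<^sup>2 / (2 * (t - (r + 1) * \<sigma>)\<^sup>2)) (at t)"
proof -
  define b where "b = (r + 1) * \<sigma>"
  have u: "t - b \<noteq> 0" using assms by (simp add: b_def)
  have w: "weight r \<sigma> = (\<lambda>t. t * (t - b + \<sigma>) / (t - b) * (t + b / 2))"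
    by (simp add: fun_eq_iff weight_def b_def algebra_simps)
  have "((\<lambda>t. t * (t - b + \<sigma>) / (t - b) * (t + b / 2)) has_real_derivative
      2 * t + b / 2 + \<sigma> - 3 * \<sigma> * b\<^sup>2 / (2 * (t - b)\<^sup>2)) (at t)"
    using u by (auto intro!: derivative_eq_intros)
      (simp add: divide_simps, simp add: algebra_simps power2_eq_square)
  then show ?thesis unfolding w by (simp add: b_def)
qed

section \<open>Dissipation of the Lyapunov function along a solution\<close>

lemma is_solution_interior:
  assumes "is_solution f r s x0 X X' X''" "t > (r - 1) * sqrt s / 2"
  shows "(X has_vector_derivative X' t) (at t)"
    and "(X' has_vector_derivative X'' t) (at t)"
    and "X'' t = - ((r + 1) / t) *\<^sub>R X' t
      - (1 + (r + 1) * sqrt s / (2 * t)) *\<^sub>R gradient f (X t + sqrt s *\<^sub>R X' t)"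
proof -
  let ?a = "(r - 1) * sqrt s / 2"
  have at: "at t within {?a..} = at t"
    using assms(2) by (intro at_within_interior) simp
  note sol = assms(1)[unfolded is_solution_def Let_def]
  show "(X has_vector_derivative X' t) (at t)" "(X' has_vector_derivative X'' t) (at t)"
    using sol assms(2) at less_imp_le by metis+
  have "X'' t + ((r + 1) / t) *\<^sub>R X' t
      + (1 + (r + 1) * sqrt s / (2 * t)) *\<^sub>R gradient f (X t + sqrt s *\<^sub>R X' t) = 0"
    using sol assms(2) by simp
  then show "X'' t = - ((r + 1) / t) *\<^sub>R X' t
      - (1 + (r + 1) * sqrt s / (2 * t)) *\<^sub>R gradient f (X t + sqrt s *\<^sub>R X' t)"
    by (simp add: eq_neg_iff_add_eq_0 algebra_simps)
qed

lemma lyapunov_deriv: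
  fixes f :: "real ^ 'd \<Rightarrow> real"
  assumes f: "f \<in> smooth_convex L" and min: "\<forall>x. f xstar \<le> f x"
    and r: "r \<ge> 2" and s: "s > 0"
    and sol: "is_solution f r s x0 X X' X''"
    and t: "t \<ge> (r + 2) * sqrt s"
  defines "Y \<equiv> X t + sqrt s *\<^sub>R X' t"
  shows "\<exists>D. (lyapunov f r s xstar X X' has_real_derivative D) (at t) \<and>
    D \<le> - ((r - 2) * t * (f Y - f xstar)) - sqrt s * t\<^sup>2 * (norm (gradient f Y))\<^sup>2"
proof -
  define \<sigma> where "\<sigma> = sqrt s"
  have \<sigma>: "\<sigma> > 0" using s by (simp add: \<sigma>_def)
  have t': "t \<ge> r * \<sigma> + 2 * \<sigma>" using t by (simp add: \<sigma>_def algebra_simps)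
  have r\<sigma>: "r * \<sigma> \<ge> 2 * \<sigma>" using r \<sigma> by simp
  have t0: "t > 0"
    using t' r\<sigma> \<sigma> by linarith
  have u: "t - (r + 1) * \<sigma> > 0"
    using t' \<sigma> by (simp add: algebra_simps)
  have interior: "t > (r - 1) * sqrt s / 2"
  proof -
    have "(r - 1) * \<sigma> = r * \<sigma> - \<sigma>" by (simp add: left_diff_distrib)
    then have "(r - 1) * \<sigma> / 2 < t" using t' r\<sigma> \<sigma> by linarith
    then show ?thesis by (simp add: \<sigma>_def)
  qed
  note X = is_solution_interior[OF sol interior, folded \<sigma>_def]
  define g where "g = gradient f Y"
  define c where "c = 1 + (r + 1) * \<sigma> / (2 * t)"
  define A where "A = weight r \<sigma> t"
  define A' where "A' = 2 * t + (r + 1) * \<sigma> / 2 + \<sigma>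
    - 3 * \<sigma> * ((r + 1) * \<sigma>)\<^sup>2 / (2 * (t - (r + 1) * \<sigma>)\<^sup>2)"
  define \<Phi> where "\<Phi> = f Y - f xstar"
  define V where "V = t *\<^sub>R X' t + r *\<^sub>R (X t - xstar)"
  have Y: "Y = X t + \<sigma> *\<^sub>R X' t" by (simp add: Y_def \<sigma>_def)
  have X'': "X'' t = - ((r + 1) / t) *\<^sub>R X' t - c *\<^sub>R g"
    using X(3) by (simp add: c_def g_def Y)
  \<comment> \<open>This is the last factor of the weight, which therefore matches the coefficient
    of the gradient in the equation multiplied by \<open>t\<close>.\<close>
  have tc: "t * c = t + (r + 1) * \<sigma> / 2"
    using t0 by (simp add: c_def field_simps)
  have "c \<ge> 1" using \<sigma> r t0 by (simp add: c_def)
  have \<Phi>0: "\<Phi> \<ge> 0" using min by (simp add: \<Phi>_def)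
  have grad: "(f has_derivative (\<lambda>h. h \<bullet> g)) (at Y)"
    using f GDERIV_gradient[of f Y] by (auto simp: smooth_convex_def gderiv_def g_def)
  have dY: "((\<lambda>u. X u + \<sigma> *\<^sub>R X' u) has_vector_derivative X' t + \<sigma> *\<^sub>R X'' t) (at t)"
    by (auto intro!: derivative_eq_intros X)
  have "(f \<circ> (\<lambda>u. X u + \<sigma> *\<^sub>R X' u) has_vector_derivative (X' t + \<sigma> *\<^sub>R X'' t) \<bullet> g) (at t)"
    using vector_derivative_diff_chain_within[OF dY, of f "\<lambda>h. h \<bullet> g"] grad has_derivative_at_withinI
    unfolding Y by blast
  then have dfY: "((\<lambda>u. f (X u + \<sigma> *\<^sub>R X' u)) has_real_derivative (X' t + \<sigma> *\<^sub>R X'' t) \<bullet> g) (at t)"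
    by (simp add: o_def has_real_derivative_iff_has_vector_derivative)
  \<comment> \<open>The derivative is \<open>(r+1) X' + t X''\<close>; the equation cancels the
    friction term and leaves only the gradient.\<close>
  have dV: "((\<lambda>u. u *\<^sub>R X' u + r *\<^sub>R (X u - xstar)) has_vector_derivative - (t * c) *\<^sub>R g) (at t)"
    using t0 by (auto intro!: derivative_eq_intros X simp: X'' algebra_simps add_divide_distrib)
  have dV2: "((\<lambda>u. (norm (u *\<^sub>R X' u + r *\<^sub>R (X u - xstar)))\<^sup>2) has_real_derivative
      2 * (V \<bullet> (- (t * c) *\<^sub>R g))) (at t)"
    unfolding power2_norm_eq_inner has_field_derivative_def
    by (rule has_derivative_eq_rhs,
        rule has_derivative_inner[OF dV[unfolded has_vector_derivative_def] dV[unfolded has_vector_derivative_def]])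
      (simp add: fun_eq_iff V_def inner_commute algebra_simps)
  have dA: "(weight r \<sigma> has_real_derivative A') (at t)"
    unfolding A'_def using u by (intro weight_deriv) simp
  have lyap: "lyapunov f r s xstar X X' = (\<lambda>u. weight r \<sigma> u * (f (X u + \<sigma> *\<^sub>R X' u) - f xstar)
      + 1 / 2 * (norm (u *\<^sub>R X' u + r *\<^sub>R (X u - xstar)))\<^sup>2)"
    by (simp add: fun_eq_iff lyapunov_def weight_def \<sigma>_def)
  define D where "D = A' * \<Phi> + A * ((X' t + \<sigma> *\<^sub>R X'' t) \<bullet> g) - t * c * (V \<bullet> g)"
  have dD: "(lyapunov f r s xstar X X' has_real_derivative D) (at t)"
    unfolding lyap by (rule derivative_eq_intros dA dfY dV2 refl)+
      (simp add: D_def A_def \<Phi>_def Y algebra_simps)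
  \<comment> \<open>The coefficient of \<open>X' t \<bullet> g\<close> in the derivative of f(Y),
    namely 1 - (r+1) \<open>\<sigma>\<close> / t.\<close>
  define q where "q = (t - (r + 1) * \<sigma>) / t"
  have "(X' t + \<sigma> *\<^sub>R X'' t) \<bullet> g = q * (X' t \<bullet> g) - \<sigma> * c * (norm g)\<^sup>2"
    unfolding X'' power2_norm_eq_inner q_def using t0 by (simp add: inner_simps field_simps)
  then have "A * ((X' t + \<sigma> *\<^sub>R X'' t) \<bullet> g) = A * q * (X' t \<bullet> g) - \<sigma> * (c * A) * (norm g)\<^sup>2"
    by (simp add: right_diff_distrib)
  \<comment> \<open>The shape of the weight serves this identity: its denominator cancels against
    \<open>q\<close>, and what remains is the coefficient of \<open>X' t \<bullet> g\<close> in
    \<open>t * c * (V \<bullet> g)\<close>.\<close>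
  moreover have "A * q = t * c * (t - r * \<sigma>)"
    using t0 u by (simp add: A_def weight_def tc q_def)
  \<comment> \<open>Substitute X = Y - \<open>\<sigma>\<close> X' in \<open>V\<close>, so that
    convexity can be applied at \<open>Y\<close>.\<close>
  moreover have "V \<bullet> g = (t - r * \<sigma>) * (X' t \<bullet> g) + r * ((Y - xstar) \<bullet> g)"
    unfolding V_def Y by (simp add: inner_simps algebra_simps)
  ultimately have D: "D = A' * \<Phi> - r * (t * c) * ((Y - xstar) \<bullet> g) - \<sigma> * (c * A) * (norm g)\<^sup>2"
    by (simp only: D_def) (simp add: ring_distribs mult_ac)
  have "f xstar \<ge> f Y + g \<bullet> (xstar - Y)"
    using f by (auto simp: smooth_convex_def g_def)
  then have "\<Phi> \<le> (Y - xstar) \<bullet> g"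
    by (simp add: \<Phi>_def inner_simps inner_commute)
  then have "r * (t * c) * \<Phi> \<le> r * (t * c) * ((Y - xstar) \<bullet> g)"
    using r t0 \<open>c \<ge> 1\<close> by (intro mult_left_mono) auto
  moreover have "(A' + (r - 2) * t) * \<Phi> \<le> r * (t * c) * \<Phi>"
  proof (rule mult_right_mono[OF _ \<Phi>0])
    have "0 \<le> 3 * \<sigma> * ((r + 1) * \<sigma>)\<^sup>2 / (2 * (t - (r + 1) * \<sigma>)\<^sup>2)"
      using \<sigma> by simp
    then have "A' \<le> 2 * t + (r + 1) * \<sigma> / 2 + \<sigma>" by (simp add: A'_def)
    \<comment> \<open>Once the subtracted fraction of \<open>A'\<close> is dropped and the terms in
      \<open>t\<close> cancel, the claim reduces to this inequality in \<open>r\<close> and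
      \<open>\<sigma>\<close>, which follows from r \<ge> 2.\<close>
    moreover have "2 * \<sigma> \<le> (r - 1) * ((r + 1) * \<sigma>)"
    proof -
      have "1 * (2 * \<sigma>) \<le> (r - 1) * ((r + 1) * \<sigma>)"
        using r \<sigma> by (intro mult_mono) auto
      then show ?thesis by simp
    qed
    ultimately show "A' + (r - 2) * t \<le> r * (t * c)"
      unfolding tc by (simp add: algebra_simps add_divide_distrib)
  qed
  moreover have "\<sigma> * t\<^sup>2 * (norm g)\<^sup>2 \<le> \<sigma> * (c * A) * (norm g)\<^sup>2"
  proof -
    have "t\<^sup>2 \<le> A"
      unfolding A_def using weight_ge \<sigma> r t by (simp add: \<sigma>_def)
    then have "1 * t\<^sup>2 \<le> c * A"
      using \<open>c \<ge> 1\<close> by (intro mult_mono) auto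
    then show ?thesis using \<sigma> by (intro mult_right_mono mult_left_mono) auto
  qed
  ultimately have "D \<le> - ((r - 2) * t * \<Phi>) - \<sigma> * t\<^sup>2 * (norm g)\<^sup>2"
    unfolding D by (simp add: algebra_simps)
  then show ?thesis using dD unfolding \<Phi>_def g_def \<sigma>_def by blast
qed

theorem theorem4p1:
  fixes f :: "real ^ 'd \<Rightarrow> real" and xstar x0 :: "real ^ 'd"
    and L r s t0 :: real and X X' X'' :: "real \<Rightarrow> real ^ 'd"
  assumes "L > 0" and "f \<in> smooth_convex L" and "\<forall>x. f xstar \<le> f x"
    and "r \<ge> 2" and "s > 0"
    and "is_solution f r s x0 X X' X''"
    and "t0 = (r + 2) * sqrt s"
  shows "(\<forall>t\<ge>t0. f (X t + sqrt s *\<^sub>R X' t) - f xstar \<le> lyapunov f r s xstar X X' t0 / t\<^sup>2)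
    \<and> ((\<lambda>t. t ^ 3 * (INF u\<in>{t0..t}. (norm (gradient f (X u + sqrt s *\<^sub>R X' u)))\<^sup>2)) \<longlongrightarrow> 0) at_top
    \<and> (r > 2 \<longrightarrow>
        ((\<lambda>t. t\<^sup>2 * ((INF u\<in>{t0..t}. f (X u + sqrt s *\<^sub>R X' u)) - f xstar)) \<longlongrightarrow> 0) at_top)"
proof -
  define Y where "Y t = X t + sqrt s *\<^sub>R X' t" for t
  define E where "E = lyapunov f r s xstar X X'"
  have \<sigma>: "sqrt s > 0" using \<open>s > 0\<close> by simp
  have t0: "t0 > 0" using assms by simp
  have \<Phi>0: "0 \<le> f (Y t) - f xstar" for t using assms(3) by simp
  have E_ge: "t\<^sup>2 * (f (Y t) - f xstar) \<le> E t" if "t \<ge> t0" for t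
  proof -
    have "t\<^sup>2 \<le> weight r (sqrt s) t"
      using weight_ge \<sigma> assms(4,7) that by simp
    then have "t\<^sup>2 * (f (Y t) - f xstar) \<le> weight r (sqrt s) t * (f (Y t) - f xstar)"
      using \<Phi>0 by (rule mult_right_mono)
    then show ?thesis
      unfolding E_def lyapunov_def weight_def Y_def by (rule order_trans) simp
  qed
  have E0: "E t \<ge> 0" if "t \<ge> t0" for t
    using E_ge[OF that] \<Phi>0[of t] by (meson mult_nonneg_nonneg order_trans zero_le_power2)
  have deriv: "\<exists>D. (E has_real_derivative D) (at t) \<and>
      D \<le> - ((r - 2) * t * (f (Y t) - f xstar)) - sqrt s * t\<^sup>2 * (norm (gradient f (Y t)))\<^sup>2"
    if "t \<ge> t0" for t
    using lyapunov_deriv[OF assms(2-6), of t] that assms(7) by (simp add: E_def Y_def)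
  \<comment> \<open>Both dissipation terms are nonnegative, so each of the three conclusions may
    keep only the one it uses, or neither.\<close>
  have drop1: "0 \<le> (r - 2) * t * (f (Y t) - f xstar)" if "t \<ge> t0" for t
    using that t0 assms(4) \<Phi>0[of t] by simp
  have drop2: "0 \<le> sqrt s * t\<^sup>2 * (norm (gradient f (Y t)))\<^sup>2" for t
    using \<sigma> by simp
  have "f (Y t) - f xstar \<le> E t0 / t\<^sup>2" if t: "t \<ge> t0" for t
  proof -
    have "E t \<le> E t0"
    proof (rule DERIV_nonpos_imp_nonincreasing[OF t])
      fix u assume "t0 \<le> u" "u \<le> t"
      then show "\<exists>y. (E has_real_derivative y) (at u) \<and> y \<le> 0"
        using deriv[of u] drop1[of u] drop2[of u] by force
    qed
    then show ?thesis using E_ge[OF t] t t0 by (simp add: field_simps)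
  qed
  moreover have "((\<lambda>t. t ^ 3 * (INF u\<in>{t0..t}. (norm (gradient f (Y u)))\<^sup>2)) \<longlongrightarrow> 0) at_top"
  proof -
    have "((\<lambda>t. t ^ Suc 2 * (INF u\<in>{t0..t}. (norm (gradient f (Y u)))\<^sup>2)) \<longlongrightarrow> 0) at_top"
    \<comment> \<open>Here k = \<open>sqrt s\<close> and n = 2: the gradient term alone drives the
      decay.\<close>
    proof (rule tendsto_power_times_INF[OF \<sigma> t0 _ E0])
      fix t assume "t0 \<le> t"
      then show "\<exists>D. (E has_real_derivative D) (at t) \<and>
          D \<le> - (sqrt s * t\<^sup>2 * (norm (gradient f (Y t)))\<^sup>2)"
        using deriv[of t] drop1[of t] by force
    qed simp_all
    then show ?thesis by (simp add: eval_nat_numeral)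
  qed
  moreover have "((\<lambda>t. t\<^sup>2 * ((INF u\<in>{t0..t}. f (Y u)) - f xstar)) \<longlongrightarrow> 0) at_top" if "r > 2"
  proof -
    have "((\<lambda>t. t ^ Suc 1 * (INF u\<in>{t0..t}. f (Y u) - f xstar)) \<longlongrightarrow> 0) at_top"
    \<comment> \<open>Here k = r - 2 and n = 1; k is positive exactly because r > 2.\<close>
    proof (rule tendsto_power_times_INF[OF _ t0 _ E0 \<Phi>0])
      fix t assume "t0 \<le> t"
      then show "\<exists>D. (E has_real_derivative D) (at t) \<and>
          D \<le> - ((r - 2) * t ^ 1 * (f (Y t) - f xstar))"
        using deriv[of t] drop2[of t] by force
    qed (use that in simp_all)
    \<comment> \<open>Only eventual equality is claimed, since [t0, t] must be nonempty to extract
      the constant.\<close>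
    moreover have "\<forall>\<^sub>F t in at_top. t ^ Suc 1 * (INF u\<in>{t0..t}. f (Y u) - f xstar)
        = t\<^sup>2 * ((INF u\<in>{t0..t}. f (Y u)) - f xstar)"
      using eventually_ge_at_top[of t0]
      by eventually_elim (use assms(3) in \<open>simp add: INF_diff_const power2_eq_square\<close>)
    ultimately show ?thesis by (rule Lim_transform_eventually)
  qed
  ultimately show ?thesis unfolding Y_def E_def by blast
qed

end
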